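(* Let $S$ be a compact, simply connected set of diameter at most $2$ in the plane $\mathbb{E}^2$ and $A$ a finite subset of $S$. Assume that for any three points of $A$ there is a point $p\in S$ such that each of the three points $a$ satisfies $[p,a]_{\mathrm{s}}\subseteq S$. Then there is a point $p\in S$ such that $[p,a]_{\mathrm{s}}\subseteq S$ for all $a\in A$.
   Context: For $x,y\in\mathbb{E}^2$ the spindle $[x,y]_{\mathrm{s}}$ is the intersection of all closed unit disks containing both $x$ and $y$ if $|x-y|\le 2$, and $[x,y]_{\mathrm{s}}=\mathbb{E}^2$ otherwise. *)

theory Defs
  imports "HOL-Analysis.Analysis"
begin

definition spindle :: "real^2 \<Rightarrow> real^2 \<Rightarrow> (real^2) set" where
  "spindle x y =
     (if dist x y \<le> 2
      then \<Inter> {cball c 1 | c :: real^2. x \<in> cball c 1 \<and> y \<in> cball c 1}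
      else UNIV)"

end

theory Submission
  imports Defs
begin

text \<open>
  For \<open>a \<in> A\<close> let \<open>V a\<close> be the set of all \<open>p \<in> S\<close> with \<open>[p, a]\<^sub>s \<subseteq> S\<close>. It is compact and
  starlike with respect to \<open>a\<close>, so its complement is connected. By Janiszewski's theorems, a finite
  family of compact plane sets with connected complements has a common point as soon as its pairwise
  intersections are connected and its triple intersections are nonempty; it remains to see that
  \<open>V a \<inter> V b\<close> is connected.

  Given \<open>p\<close> and \<open>q\<close> in \<open>V a \<inter> V b\<close>, fill the holes of the union of the four spindles joining them to
  \<open>a\<close> and \<open>b\<close>. The result \<open>F\<close> lies in \<open>S\<close>, since loops in the four spindles are contractible in \<open>S\<close>
  and hence do not wind around points outside \<open>S\<close>; note that \<open>S\<close> itself may separate the plane, like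
  the Warsaw circle. For \<open>r\<close> in the triangle \<open>p q a\<close>, the spindle \<open>[r, a]\<^sub>s\<close> is covered by
  \<open>[p, a]\<^sub>s\<close>, \<open>[q, a]\<^sub>s\<close> and the triangles \<open>p r a\<close>, \<open>q r a\<close>. Choosing a Radon partition
  of \<open>{p, q, a, b}\<close>, one obtains a polygonal path from \<open>p\<close> to \<open>q\<close> of at most two segments, all of
  whose points see \<open>a\<close> and \<open>b\<close> via \<open>F\<close>.
\<close>

section \<open>A topological Helly theorem in the plane\<close>

text \<open>Two bounded sets do not cover the space, so the connected complements meet and their
  union is connected.\<close>

lemma connected_Compl_Int:
  fixes A B :: "'a::euclidean_space set"
  assumes "compact A" "compact B" "connected (- A)" "connected (- B)"
  shows "connected (- (A \<inter> B))"
proof -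
  have "- A \<inter> - B \<noteq> {}"
    using compact_Un[OF assms(1,2)] not_bounded_UNIV by (metis Compl_Un Compl_eq_Compl_iff Compl_empty_eq compact_imp_bounded double_complement)
  then show ?thesis
    using connected_Un[OF assms(3,4)] by (simp add: Compl_Int)
qed

text \<open>The pieces \<open>A \<inter> B\<close> and \<open>A \<inter> C\<close> have the union
  \<open>A \<inter> (B \<union> C)\<close>, which does not separate the plane; Janiszewski's dual
  theorem then makes their intersection connected.\<close>

lemma connected_Int3:
  fixes A B C :: "complex set"
  assumes "compact A" "compact B" "compact C"
    and "connected (- A)" "connected (- B)" "connected (- C)"
    and AB: "connected (A \<inter> B)" and AC: "connected (A \<inter> C)" and BC: "connected (B \<inter> C)"
    and ne: "A \<inter> B \<inter> C \<noteq> {}"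
  shows "connected (A \<inter> B \<inter> C)"
proof -
  have "connected (- (B \<union> C))"
    using assms by (intro Janiszewski_connected) (auto intro: compact_imp_closed)
  then have "connected (- (A \<inter> (B \<union> C)))"
    using assms by (intro connected_Compl_Int) auto
  then have full: "connected (- ((A \<inter> B) \<union> (A \<inter> C)))"
    by (simp only: Int_Un_distrib)
  have "connected ((A \<inter> B) \<inter> (A \<inter> C))"
    by (rule Janiszewski_dual[OF _ _ AB AC full]) (intro compact_Int assms)+
  moreover have "(A \<inter> B) \<inter> (A \<inter> C) = A \<inter> B \<inter> C" by auto
  ultimately show ?thesis by simp
qed

text \<open>Without a common point, \<open>A \<inter> B \<inter> D\<close> and
  \<open>A \<inter> C \<inter> D\<close> would be disjoint, closed and nonempty. But their union is
  the intersection of \<open>(A \<inter> B) \<union> (A \<inter> C)\<close> with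
  \<open>A \<inter> D\<close>, which is connected by the dual theorem.\<close>

lemma Int4_nonempty:
  fixes A B C D :: "complex set"
  assumes cpt: "compact A" "compact B" "compact C" "compact D"
    and full: "connected (- A)" "connected (- B)" "connected (- C)" "connected (- D)"
    and con: "connected (A \<inter> B)" "connected (A \<inter> C)" "connected (A \<inter> D)"
      "connected (B \<inter> C)" "connected (B \<inter> D)" "connected (C \<inter> D)"
    and ne: "A \<inter> B \<inter> C \<noteq> {}" "A \<inter> B \<inter> D \<noteq> {}" "A \<inter> C \<inter> D \<noteq> {}" "B \<inter> C \<inter> D \<noteq> {}"
  shows "A \<inter> B \<inter> C \<inter> D \<noteq> {}"
proof
  assume empty: "A \<inter> B \<inter> C \<inter> D = {}"
  have BC: "connected (- (B \<union> C))"
    using assms by (intro Janiszewski_connected) (auto intro: compact_imp_closed)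
  have "connected ((B \<inter> D) \<union> (C \<inter> D))"
    using con ne by (intro connected_Un) auto
  then have "connected ((B \<union> C) \<inter> D)"
    by (simp only: Int_Un_distrib2)
  then have "connected (- (B \<union> C \<union> D))"
    by (rule Janiszewski_connected[rotated 2]) (use cpt full BC in \<open>simp_all add: compact_imp_closed compact_Un del: Compl_Un\<close>)
  then have "connected (- (A \<inter> (B \<union> C \<union> D)))"
    using cpt full by (intro connected_Compl_Int) (auto intro: compact_Un)
  then have full_ABCD: "connected (- ((A \<inter> B) \<union> (A \<inter> C) \<union> (A \<inter> D)))"
    by (simp only: Int_Un_distrib)
  have con_ABC: "connected ((A \<inter> B) \<union> (A \<inter> C))"
    using con ne by (intro connected_Un) auto
  have "connected (((A \<inter> B) \<union> (A \<inter> C)) \<inter> (A \<inter> D))"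
    by (rule Janiszewski_dual[OF _ _ con_ABC con(3) full_ABCD]) (intro compact_Un compact_Int cpt)+
  moreover have "((A \<inter> B) \<union> (A \<inter> C)) \<inter> (A \<inter> D) = (A \<inter> B \<inter> D) \<union> (A \<inter> C \<inter> D)" by auto
  ultimately have c: "connected ((A \<inter> B \<inter> D) \<union> (A \<inter> C \<inter> D))" by simp
  have cl: "closed (A \<inter> B \<inter> D)" "closed (A \<inter> C \<inter> D)"
    using cpt by (auto intro!: closed_Int compact_imp_closed)
  show False
    using connected_closedD[OF c _ _ cl] empty ne by blast
qed

text \<open>The induction step intersects every set with the new one, \<open>V n\<close>; the two
  preceding lemmas restore the hypotheses on pairs and triples. Indices may coincide, so each
  \<open>V i\<close> is itself connected and any two of the sets meet.\<close>

proposition planar_Helly: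
  fixes V :: "'i \<Rightarrow> complex set"
  assumes "finite I" "I \<noteq> {}"
    and "\<And>i. i \<in> I \<Longrightarrow> compact (V i)" "\<And>i. i \<in> I \<Longrightarrow> connected (- V i)"
    and "\<And>i j. i \<in> I \<Longrightarrow> j \<in> I \<Longrightarrow> connected (V i \<inter> V j)"
    and "\<And>i j k. i \<in> I \<Longrightarrow> j \<in> I \<Longrightarrow> k \<in> I \<Longrightarrow> V i \<inter> V j \<inter> V k \<noteq> {}"
  shows "(\<Inter>i\<in>I. V i) \<noteq> {}"
  using assms
proof (induction I arbitrary: V rule: finite_ne_induct)
  case (singleton i)
  then show ?case by fastforce
next
  case (insert n I)
  let ?W = "\<lambda>i. V i \<inter> V n"
  have "(\<Inter>i\<in>I. ?W i) \<noteq> {}"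
  proof (rule insert.IH)
    fix i assume i: "i \<in> I"
    show "compact (?W i)" using i insert.prems(1) by (intro compact_Int) auto
    show "connected (- ?W i)" using i insert.prems(1,2) by (intro connected_Compl_Int) auto
    fix j assume j: "j \<in> I"
    have eq: "?W i \<inter> ?W j = V i \<inter> V j \<inter> V n" by auto
    show "connected (?W i \<inter> ?W j)"
      unfolding eq using i j insert.prems by (intro connected_Int3) auto
    fix k assume k: "k \<in> I"
    have eq: "?W i \<inter> ?W j \<inter> ?W k = V i \<inter> V j \<inter> V k \<inter> V n" by auto
    show "?W i \<inter> ?W j \<inter> ?W k \<noteq> {}"
      unfolding eq using i j k insert.prems by (intro Int4_nonempty) auto
  qed
  then show ?case using insert.hyps(2) by auto
qed

section \<open>Filling holes\<close>

text \<open>If a point \<open>z\<close> of \<open>inside T\<close> were missing from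
  \<open>S\<close>, loops in \<open>T\<close> would contract within \<open>S\<close>, away from
  \<open>z\<close>, so \<open>x - z\<close> would have a continuous logarithm on \<open>T\<close>.
  By Borsuk's criterion \<open>z\<close> would then lie in the unbounded component of
  \<open>- T\<close>.\<close>

lemma simply_connected_imp_inside_subset:
  fixes S T :: "complex set"
  assumes S: "simply_connected S" and TS: "T \<subseteq> S" and T: "compact T" "path_connected T" "locally path_connected T"
  shows "inside T \<subseteq> S"
proof
  fix z assume z: "z \<in> inside T"
  show "z \<in> S"
  proof (rule ccontr)
    assume zS: "z \<notin> S"
    then have zT: "z \<notin> T" using TS by auto
    obtain t where t: "t \<in> T" using z by fastforce
    have tz: "t - z \<noteq> 0" using t zT by auto
    \<comment> \<open>Lifting criterion for the covering \<open>exp\<close> of the punctured plane;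
      it asks for \<open>T\<close> to be locally path connected.\<close>
    obtain g where g: "continuous_on T g" "g t = Ln (t - z)" "\<And>y. y \<in> T \<Longrightarrow> exp (g y) = y - z"
    proof (rule covering_space_lift_stronger[OF covering_space_exp_punctured_plane, of "Ln (t - z)" t T "\<lambda>x. x - z"])
      show "continuous_on T (\<lambda>x. x - z)" by (intro continuous_intros)
      show "(\<lambda>x. x - z) \<in> T \<rightarrow> - {0}" using zT by auto
      show "t - z = exp (Ln (t - z))" using tz by simp
      fix r assume r: "path r" "path_image r \<subseteq> T" "pathstart r = t" "pathfinish r = t"
      have "homotopic_paths S r (linepath t t)"
        using S r TS unfolding simply_connected_eq_contractible_path by (metis order_trans)
      then have "homotopic_paths (- {0}) ((\<lambda>x. x - z) \<circ> r) ((\<lambda>x. x - z) \<circ> linepath t t)"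
        by (rule homotopic_paths_continuous_image) (use zS in \<open>auto intro!: continuous_intros\<close>)
      moreover have "(\<lambda>x. x - z) \<circ> linepath t t = linepath (t - z) (t - z)"
        by (auto simp: linepath_def algebra_simps)
      ultimately show "\<exists>b. homotopic_paths (- {0}) ((\<lambda>x. x - z) \<circ> r) (linepath b b)" by metis
    qed (use t T in auto)
    \<comment> \<open>\<open>Im (g x)\<close> is a continuous choice of the angle of
      \<open>x - z\<close>.\<close>
    have "\<exists>c. homotopic_with_canon (\<lambda>h. True) T (sphere 0 1) (\<lambda>x. inverse (norm (x - z)) *\<^sub>R (x - z)) (\<lambda>x. c)"
      unfolding inessential_eq_continuous_logarithm_circle
    proof (intro exI conjI ballI)
      show "continuous_on T (\<lambda>x. Im (g x))" using g(1) by (intro continuous_intros)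
      fix x assume x: "x \<in> T"
      have "x - z = exp (g x)" using g(3)[OF x] by simp
      also have "\<dots> = exp (complex_of_real (Re (g x)) + \<i> * complex_of_real (Im (g x)))"
        by (metis complex_eq)
      also have "\<dots> = of_real (exp (Re (g x))) * exp (\<i> * complex_of_real (Im (g x)))"
        by (simp add: exp_add exp_of_real)
      finally have eq: "x - z = exp (Re (g x)) *\<^sub>R exp (\<i> * complex_of_real (Im (g x)))"
        by (simp add: scaleR_conv_of_real)
      then show "inverse (norm (x - z)) *\<^sub>R (x - z) = exp (\<i> * complex_of_real (Im (g x)))"
        by simp
    qed
    then have "\<not> bounded (connected_component_set (- T) z)"
      using Borsuk_map_essential_bounded_component[OF T(1) zT] by blast
    then show False using z by (simp add: inside_def)
  qed
qed

text \<open>The connected set \<open>- F\<close> avoids the frontier of \<open>K\<close>, so it lies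
  in \<open>K\<close> or in \<open>- K\<close>; being unbounded, it lies in
  \<open>- K\<close>.\<close>

lemma subset_if_frontier_subset:
  fixes F K :: "'a::euclidean_space set"
  assumes "compact F" "connected (- F)" "bounded K" "frontier K \<subseteq> F"
  shows "K \<subseteq> F"
proof (rule ccontr)
  assume "\<not> K \<subseteq> F"
  then have "- F \<inter> K \<noteq> {}" by auto
  moreover have "- F - K \<noteq> {}"
  proof
    assume "- F - K = {}"
    then have "UNIV = F \<union> K" by auto
    then show False using assms(1,3) not_bounded_UNIV by (metis bounded_Un compact_imp_bounded)
  qed
  ultimately show False
    using connected_Int_frontier[OF assms(2)] assms(4) by blast
qed

section \<open>Spindles\<close>

text \<open>For points at distance greater than 2 no unit disc contains both, and the intersection below is
  \<open>UNIV\<close>; so the case distinction in \<open>spindle\<close> is redundant.\<close>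

definition disc_hull :: "'a::metric_space \<Rightarrow> 'a \<Rightarrow> 'a set" where
  "disc_hull x y = \<Inter> {cball c 1 | c. x \<in> cball c 1 \<and> y \<in> cball c 1}"

lemma mem_disc_hull:
  "w \<in> disc_hull x y \<longleftrightarrow> (\<forall>c. dist c x \<le> 1 \<longrightarrow> dist c y \<le> 1 \<longrightarrow> dist c w \<le> 1)"
  unfolding disc_hull_def by auto

lemma left_in_disc_hull [simp]: "x \<in> disc_hull x y"
  and right_in_disc_hull [simp]: "y \<in> disc_hull x y"
  by (auto simp: mem_disc_hull)

lemma disc_hull_mono: "r \<in> disc_hull p a \<Longrightarrow> disc_hull r a \<subseteq> disc_hull p a"
  by (auto simp: mem_disc_hull)

lemma closed_disc_hull: "closed (disc_hull x y)"
  unfolding disc_hull_def by (intro closed_Inter) auto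

lemma convex_disc_hull: "convex (disc_hull x (y::'a::real_normed_vector))"
  unfolding disc_hull_def by (intro convex_Inter) auto

lemma closed_segment_subset_disc_hull: "closed_segment x y \<subseteq> disc_hull x (y::'a::real_normed_vector)"
  by (simp add: closed_segment_subset convex_disc_hull)

lemma compact_disc_hull:
  fixes x y :: "'a::euclidean_space"
  assumes "dist x y \<le> 2"
  shows "compact (disc_hull x y)"
proof -
  have "disc_hull x y \<subseteq> cball (midpoint x y) 1"
    using assms by (auto simp: mem_disc_hull dist_midpoint)
  then have "bounded (disc_hull x y)"
    using bounded_cball bounded_subset by blast
  then show ?thesis by (simp add: compact_eq_bounded_closed closed_disc_hull)
qed

lemma disc_hull_refl [simp]: "disc_hull x (x::'a::euclidean_space) = {x}"
proof -
  have "w = x" if w: "w \<in> disc_hull x x" for w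
  proof (rule ccontr)
    assume ne: "w \<noteq> x"
    \<comment> \<open>The unit disc touching \<open>x\<close> from the side opposite to
      \<open>w\<close>; its centre has distance \<open>1 + norm (w - x)\<close> from
      \<open>w\<close>.\<close>
    let ?c = "x - (1 / norm (w - x)) *\<^sub>R (w - x)"
    have "dist ?c x \<le> 1" using ne by (simp add: dist_norm)
    then have "dist ?c w \<le> 1" using w by (auto simp: mem_disc_hull)
    moreover have "?c - w = - ((1 + 1 / norm (w - x)) *\<^sub>R (w - x))" by (simp add: algebra_simps)
    then have "dist ?c w = (1 + 1 / norm (w - x)) * norm (w - x)"
      by (simp add: dist_norm)
    moreover have "\<dots> = norm (w - x) + 1" using ne by (simp add: field_simps)
    ultimately show False using ne by simp
  qed
  then show ?thesis by auto
qed

text \<open>A point \<open>w\<close> of the hull of \<open>l\<close> and \<open>a\<close> need not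
  belong to the hulls of \<open>x n\<close> and \<open>a\<close>, so points \<open>v\<close>
  strictly between \<open>a\<close> and \<open>w\<close> come first. If \<open>v\<close> were
  outside \<open>S\<close>, centres of unit discs excluding it would accumulate at some
  \<open>e\<close> whose disc contains \<open>l\<close> and \<open>a\<close>, hence
  \<open>w\<close>, but does not have \<open>v\<close> in its interior. Strict convexity of the disc
  forbids this.\<close>

lemma closed_disc_hull_kernel:
  fixes S :: "'a::euclidean_space set"
  assumes "closed S"
  shows "closed {p \<in> S. disc_hull p a \<subseteq> S}"
  unfolding closed_sequential_limits
proof (intro allI impI, elim conjE)
  fix x l assume x: "\<forall>n. x n \<in> {p \<in> S. disc_hull p a \<subseteq> S}" and l: "x \<longlonglongrightarrow> l"
  have lS: "l \<in> S" using assms x l unfolding closed_sequential_limits by blast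
  have aS: "a \<in> S" using x right_in_disc_hull by blast
  have "w \<in> S" if w: "w \<in> disc_hull l a" for w
  proof (cases "w = a")
    case False
    have "open_segment a w \<subseteq> S"
    proof
      fix v assume v: "v \<in> open_segment a w"
      show "v \<in> S"
      proof (rule ccontr)
        assume "v \<notin> S"
        then have "\<forall>n. \<exists>d. dist d (x n) \<le> 1 \<and> dist d a \<le> 1 \<and> dist d v > 1"
          using x by (metis (no_types, lifting) mem_Collect_eq mem_disc_hull not_le subsetD)
        then obtain d where d: "\<And>n. dist (d n) (x n) \<le> 1" "\<And>n. dist (d n) a \<le> 1" "\<And>n. dist (d n) v > 1"
          by metis
        have "\<forall>n. d n \<in> cball a 1" using d(2) by (simp add: dist_commute)
        then obtain e k where k: "strict_mono k" and e: "(d \<circ> k) \<longlonglongrightarrow> e"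
          using compact_cball[of a 1] unfolding compact_def by blast
        have xk: "(x \<circ> k) \<longlonglongrightarrow> l" using LIMSEQ_subseq_LIMSEQ[OF l k] .
        have "dist e l \<le> 1"
          by (rule LIMSEQ_le_const2[OF tendsto_dist[OF e xk]]) (use d(1) in auto)
        moreover have "dist e a \<le> 1"
          by (rule LIMSEQ_le_const2[OF tendsto_dist[OF e tendsto_const]]) (use d(2) in auto)
        moreover have "1 \<le> dist e v"
          by (rule LIMSEQ_le_const[OF tendsto_dist[OF e tendsto_const]]) (use d(3) less_imp_le in auto)
        ultimately show False
          using w dist_decreases_open_segment[OF v, of e] by (force simp: mem_disc_hull)
      qed
    qed
    then have "closure (open_segment a w) \<subseteq> S" using assms by (rule closure_minimal)
    then show ?thesis using False by auto
  qed (simp add: aS)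
  then show "l \<in> {p \<in> S. disc_hull p a \<subseteq> S}" using lS by auto
qed

text \<open>The hulls shrink as \<open>p\<close> moves along the segment towards \<open>a\<close>,
  so \<open>a\<close> is a star centre.\<close>

lemma starlike_disc_hull_kernel:
  fixes S :: "'a::euclidean_space set"
  assumes "a \<in> S"
  shows "starlike {p \<in> S. disc_hull p a \<subseteq> S}"
proof -
  have "r \<in> S \<and> disc_hull r a \<subseteq> S" if "disc_hull p a \<subseteq> S" "r \<in> closed_segment a p" for p r
    using that closed_segment_subset_disc_hull[of a p] disc_hull_mono[of r p a]
    by (metis closed_segment_commute closed_segment_subset_disc_hull subset_iff)
  then show ?thesis using assms unfolding starlike_def by (intro bexI[of _ a]) auto
qed

text \<open>The hypothesis on \<open>p\<close> puts it on or beyond the tangent at \<open>r\<close>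
  to the unit sphere around \<open>c\<close>. A unit disc around \<open>d\<close> that contains
  \<open>p\<close> and \<open>a\<close> but not \<open>w\<close> also misses \<open>r\<close>. The
  bisector of \<open>c\<close> and \<open>d\<close> then has \<open>r\<close> and \<open>w\<close>
  strictly on one side and \<open>a\<close> and \<open>p\<close> weakly on the other, so within the
  cone at \<open>r\<close> the point \<open>w\<close> cannot pass the segment from \<open>a\<close>
  to \<open>p\<close>.\<close>

lemma disc_hull_subset_triangle:
  fixes a p r c w :: "'a::euclidean_space"
  assumes c: "dist c r = 1" "dist c a = 1" and p: "(p - r) \<bullet> (c - r) \<le> 0"
    and w: "w \<in> disc_hull r a" "w - r = s *\<^sub>R (a - r) + t *\<^sub>R (p - r)" "0 \<le> s" "0 \<le> t"
  shows "w \<in> disc_hull p a \<union> convex hull {p, r, a}"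
proof (rule ccontr)
  assume w_out: "w \<notin> disc_hull p a \<union> convex hull {p, r, a}"
  then obtain d where d: "dist d p \<le> 1" "dist d a \<le> 1" "dist d w > 1"
    by (auto simp: mem_disc_hull not_le)
  have dr: "dist d r > 1" using w(1) d by (metis mem_disc_hull not_le)
  have cw: "dist c w \<le> 1" using w(1) c by (simp add: mem_disc_hull)
  have norm_less: "x \<bullet> x < y \<bullet> y" if "norm x < norm y" for x y :: 'a
    using that by (simp add: norm_lt)
  \<comment> \<open>\<open>g\<close> is affine, nonnegative at \<open>a\<close> and \<open>p\<close>, and negative at \<open>r\<close> and \<open>w\<close>; this bounds \<open>s + t\<close>.\<close>
  define g where "g x = (x - c) \<bullet> (x - c) - (x - d) \<bullet> (x - d)" for x
  have gr: "g r < 0" and gw: "g w < 0"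
    using norm_less[of "r - c" "r - d"] norm_less[of "w - c" "w - d"] c cw dr d
    by (auto simp: g_def dist_norm norm_minus_commute)
  have ga: "g a \<ge> 0"
    using c(2) d(2) by (simp add: g_def dist_norm norm_minus_commute flip: norm_le)
  have "1 \<le> (p - c) \<bullet> (p - c)"
  proof -
    have "(p - c) \<bullet> (p - c) = (p - r) \<bullet> (p - r) - 2 * ((p - r) \<bullet> (c - r)) + (c - r) \<bullet> (c - r)"
      by (simp add: inner_simps inner_commute)
    moreover have "(c - r) \<bullet> (c - r) = 1" using c(1) by (simp add: dist_norm norm_eq_1)
    moreover have "0 \<le> (p - r) \<bullet> (p - r)" by simp
    ultimately show ?thesis using p by linarith
  qed
  moreover have "(p - d) \<bullet> (p - d) \<le> 1"
    using d(1) by (simp add: dist_norm norm_minus_commute power_le_one flip: power2_norm_eq_inner)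
  ultimately have gp: "g p \<ge> 0" by (simp add: g_def)
  have weq: "w = (1 - s - t) *\<^sub>R r + s *\<^sub>R a + t *\<^sub>R p"
    using w(2) by (simp add: algebra_simps)
  have "g w = (1 - s - t) * g r + s * g a + t * g p"
    unfolding g_def weq by (simp add: inner_simps algebra_simps inner_commute)
  moreover have "(1 - s - t) * g r \<ge> 0" if "s + t \<ge> 1"
    using that gr by (intro mult_nonpos_nonpos) auto
  ultimately have "s + t < 1"
    using gw ga gp w(3,4) by (smt (verit) mult_nonneg_nonneg)
  then have "w \<in> convex hull {p, r, a}"
    unfolding convex_hull_3 using w(3,4) weq
    by (intro CollectI exI[of _ t] exI[of _ "1 - s - t"] exI[of _ s]) auto
  then show False using w_out by simp
qed

text \<open>The content of \<open>in_disc_hull_opposite\<close> below, in the coordinates with origin \<open>r\<close> whose second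
  axis points to the centre \<open>c\<close>: there \<open>a = (ax, ay)\<close>, \<open>q = (-qx, -qy)\<close>, \<open>c = (0, 1)\<close>, and
  \<open>(x, y)\<close> is the centre of any unit disc containing \<open>a\<close> and \<open>q\<close>.\<close>

lemma square_sum_le_1:
  fixes ax ay qx qy x y :: real
  assumes "0 \<le> ax" "0 < ay" "ax\<^sup>2 + ay\<^sup>2 = 2 * ay" "0 \<le> qx" "0 \<le> qy" "qy * ax \<le> ay * qx"
    and xa: "(x - ax)\<^sup>2 + (y - ay)\<^sup>2 \<le> 1" and xq: "(x + qx)\<^sup>2 + (y + qy)\<^sup>2 \<le> 1"
  shows "x\<^sup>2 + y\<^sup>2 \<le> 1"
proof (rule ccontr)
  assume *: "\<not> ?thesis"
  have xya: "x * ax + y * ay > ay"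
    using xa * assms(3) by (simp add: power2_eq_square algebra_simps)
  have xyq: "x * qx + y * qy < 0"
  proof -
    have "x\<^sup>2 + y\<^sup>2 + (qx\<^sup>2 + qy\<^sup>2) + 2 * (x * qx + y * qy) \<le> 1"
      using xq by (simp add: power2_eq_square algebra_simps)
    moreover have "0 \<le> qx\<^sup>2 + qy\<^sup>2" by simp
    moreover have "1 < x\<^sup>2 + y\<^sup>2" using * by simp
    ultimately show ?thesis by (smt (verit))
  qed
  \<comment> \<open>For \<open>y \<ge> 0\<close>, \<open>xyq\<close> forces \<open>x < 0\<close>, so
    \<open>xya\<close> gives \<open>y > 1\<close>, which is too far from \<open>q\<close>. For
    \<open>y < 0\<close>, the bounds on \<open>x\<close> from \<open>xya\<close> and
    \<open>xyq\<close> contradict the slope condition \<open>qy * ax \<le> ay * qx\<close>.\<close>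
  show False
  proof (cases "0 \<le> y")
    case True
    have "x * qx < 0" using xyq True assms(5) by (smt (verit) mult_nonneg_nonneg)
    then have "x < 0" using assms(4) by (simp add: mult_less_0_iff)
    then have "x * ax \<le> 0" using assms(1) by (simp add: mult_nonpos_nonneg)
    then have "y * ay > 1 * ay" using xya by simp
    then have "y > 1" using assms(2) by simp
    then have "1 < (y + qy)\<^sup>2" using assms(5) by (simp add: one_less_power)
    then show False using xq by (smt (verit) zero_le_power2)
  next
    case False
    define z where "z = - y"
    have z: "0 < z" "y = - z" using False by (auto simp: z_def)
    have "x * ax > (1 + z) * ay" using xya z by (simp add: algebra_simps)
    then have xax: "x * ax * qx \<ge> (1 + z) * (ay * qx)"
      using assms(4) by (metis less_imp_le mult.assoc mult_right_mono)
    have "x * ax > 0" using \<open>x * ax > (1 + z) * ay\<close> assms(2) z by (smt (verit) mult_pos_pos)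
    then have "ax > 0" using assms(1) by (cases "ax = 0") auto
    moreover have "x * qx < z * qy" using xyq z by simp
    ultimately have "ax * (x * qx) < ax * (z * qy)" by (simp add: mult_strict_left_mono)
    then have "z * (qy * ax) > (1 + z) * (ay * qx)" using xax by (simp add: algebra_simps)
    moreover have "(1 + z) * (ay * qx) \<ge> (1 + z) * (qy * ax)"
      using assms(6) z by (simp add: mult_left_mono)
    moreover have "qy * ax \<ge> 0" using assms by simp
    ultimately show False by (simp add: algebra_simps)
  qed
qed

section \<open>Covering a spindle by two spindles and two triangles\<close>

definition pdet :: "complex \<Rightarrow> complex \<Rightarrow> real" where
  "pdet x y = Re x * Im y - Im x * Re y"

text \<open>The sign \<open>\<sigma>\<close> selects a side of the line through \<open>r\<close> and \<open>a\<close>, so that the same lemmas serve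
  both sides; \<open>c\<close> lies on the side of that line opposite to the selected one.\<close>

lemma ex_unit_disc_centre:
  fixes r a :: complex and \<sigma> :: real
  assumes "r \<noteq> a" "dist r a \<le> 2" "\<sigma> = 1 \<or> \<sigma> = -1"
  obtains c where "dist c r = 1" "dist c a = 1" "0 \<le> \<sigma> * pdet (c - r) (a - r)"
proof -
  define E where "E = a - r"
  define n where "n = norm E"
  \<comment> \<open>By Pythagoras the centre has distance \<open>sqrt (1 - n\<^sup>2 / 4)\<close>
    from the midpoint of the chord; dividing by \<open>n\<close> normalises the rotated
    \<open>E\<close> used in \<open>u\<close>.\<close>
  define k where "k = sqrt (1 - n\<^sup>2 / 4) / n"
  define u where "u = Complex (Re E / 2 + \<sigma> * k * Im E) (Im E / 2 - \<sigma> * k * Re E)"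
  have n: "0 < n" "n \<le> 2" using assms by (auto simp: n_def E_def dist_norm norm_minus_commute)
  have n2: "n\<^sup>2 = (Re E)\<^sup>2 + (Im E)\<^sup>2" by (simp add: n_def cmod_power2)
  have "n\<^sup>2 \<le> 2\<^sup>2" using n by (intro power_mono) auto
  then have k: "k\<^sup>2 * n\<^sup>2 = 1 - n\<^sup>2 / 4" "0 \<le> k"
    using n by (auto simp: k_def power_divide)
  have \<sigma>: "\<sigma>\<^sup>2 = 1" using assms(3) by auto
  have "(norm u)\<^sup>2 = n\<^sup>2 / 4 + \<sigma>\<^sup>2 * (k\<^sup>2 * n\<^sup>2)"
    unfolding cmod_power2 u_def n2 by (simp add: power2_eq_square field_simps)
  then have "(norm u)\<^sup>2 = 1\<^sup>2" using k \<sigma> by simp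
  then have "norm u = 1" by (rule power2_eq_imp_eq) auto
  moreover have "(norm (u - E))\<^sup>2 = n\<^sup>2 / 4 + \<sigma>\<^sup>2 * (k\<^sup>2 * n\<^sup>2)"
    unfolding cmod_power2 u_def n2 by (simp add: power2_eq_square field_simps)
  then have "(norm (u - E))\<^sup>2 = 1\<^sup>2" using k \<sigma> by simp
  then have "norm (u - E) = 1" by (rule power2_eq_imp_eq) auto
  moreover have "\<sigma> * pdet u E = \<sigma>\<^sup>2 * k * n\<^sup>2"
    unfolding pdet_def u_def n2 by (simp add: power2_eq_square field_simps)
  ultimately show thesis
    using that[of "r + u"] \<sigma> k by (simp add: dist_norm E_def algebra_simps)
qed

text \<open>Law of cosines; it places points of the disc on the inner side of the tangent at
  \<open>r\<close>.\<close>

lemma norm_square_le_inner_centre: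
  fixes a r c :: "'a::real_inner"
  assumes "dist c r = 1" "dist c w \<le> 1"
  shows "norm (w - r) ^ 2 \<le> 2 * ((w - r) \<bullet> (c - r))"
proof -
  have "(norm (c - w))\<^sup>2 = (norm (c - r))\<^sup>2 + (norm (w - r))\<^sup>2 - 2 * ((w - r) \<bullet> (c - r))"
    by (simp add: power2_norm_eq_inner inner_simps inner_commute)
  moreover have "(norm (c - w))\<^sup>2 \<le> 1" using assms(2) by (simp add: dist_norm power_le_one)
  ultimately show ?thesis using assms(1) by (simp add: dist_norm)
qed

text \<open>Cramer's rule for \<open>W\<close> in the basis \<open>E\<close>, \<open>P\<close>: the
  side conditions give \<open>t \<ge> 0\<close>, and then the products with \<open>u\<close> give
  \<open>s \<ge> 0\<close>. The first alternative is the degenerate case of parallel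
  \<open>E\<close> and \<open>P\<close>.\<close>

lemma pdet_cone:
  fixes E P W u :: complex and \<sigma> :: real
  assumes "\<sigma> = 1 \<or> \<sigma> = -1" "0 < E \<bullet> u" "P \<bullet> u \<le> 0" "0 \<le> W \<bullet> u" "0 \<le> \<sigma> * pdet E P" "0 \<le> \<sigma> * pdet E W"
  shows "(\<exists>k\<le>0. P = k *\<^sub>R E) \<or> (\<exists>s\<ge>0. \<exists>t\<ge>0. W = s *\<^sub>R E + t *\<^sub>R P)"
proof (cases "pdet E P = 0")
  case True
  define k where "k = (P \<bullet> E) / (E \<bullet> E)"
  have "E \<noteq> 0" using assms(2) by auto
  then have EE: "E \<bullet> E > 0" by simp
  have "(E \<bullet> E) *\<^sub>R P = (P \<bullet> E) *\<^sub>R E"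
    using True unfolding pdet_def complex_eq_iff inner_complex_def 
    by (simp add: field_simps)
  then have "P = k *\<^sub>R E" using EE unfolding k_def
    by (metis divide_inverse_commute scaleR_scaleR less_irrefl scaleR_left_imp_eq right_inverse scaleR_one vector_fraction_eq_iff divideR_right)
  moreover from this have "k * (E \<bullet> u) \<le> 0" using assms(3) by simp
  then have "k \<le> 0" using assms(2) by (simp add: mult_le_0_iff)
  ultimately show ?thesis by auto
next
  case False
  define D where "D = pdet E P"
  have D: "D \<noteq> 0" "0 < \<sigma> * D" using False assms(1,5) by (auto simp: D_def)
  define s t where "s = pdet W P / D" and "t = pdet E W / D"
  have "D *\<^sub>R W = pdet W P *\<^sub>R E + pdet E W *\<^sub>R P"
    unfolding D_def pdet_def complex_eq_iff by (simp add: algebra_simps)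
  then have "W = (1 / D) *\<^sub>R (pdet W P *\<^sub>R E + pdet E W *\<^sub>R P)"
    using D(1) by (metis divide_self_if scaleR_one scaleR_scaleR times_divide_eq_left mult_1)
  then have W: "W = s *\<^sub>R E + t *\<^sub>R P" by (simp add: s_def t_def scaleR_add_right)
  have "t = (\<sigma> * pdet E W) / (\<sigma> * D)" using assms(1) by (auto simp: t_def)
  then have t: "0 \<le> t" using D(2) assms(6) by (metis divide_nonneg_pos)
  have "W \<bullet> u = s * (E \<bullet> u) + t * (P \<bullet> u)" by (simp add: W inner_simps)
  moreover have "t * (P \<bullet> u) \<le> 0" using t assms(3) by (simp add: mult_nonneg_nonpos)
  ultimately have "0 \<le> s * (E \<bullet> u)" using assms(4) by linarith
  then have "0 \<le> s" using assms(2) by (simp add: zero_le_mult_iff)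
  then show ?thesis using W t by blast
qed

text \<open>With \<open>u = c - r\<close> in \<open>pdet_cone\<close>, \<open>w\<close> lies in the
  cone at \<open>r\<close> spanned by \<open>a\<close> and \<open>p\<close>, where
  \<open>disc_hull_subset_triangle\<close> applies. In the degenerate case \<open>r\<close> lies on
  the segment from \<open>p\<close> to \<open>a\<close>, and \<open>disc_hull_mono\<close>
  suffices.\<close>

lemma disc_hull_side:
  fixes a p r c w :: complex and \<sigma> :: real
  assumes \<sigma>: "\<sigma> = 1 \<or> \<sigma> = -1" and c: "dist c r = 1" "dist c a = 1" and "r \<noteq> a"
    and p: "(p - r) \<bullet> (c - r) \<le> 0" "0 \<le> \<sigma> * pdet (a - r) (p - r)"
    and w: "w \<in> disc_hull r a" "0 \<le> \<sigma> * pdet (a - r) (w - r)"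
  shows "w \<in> disc_hull p a \<union> convex hull {p, r, a}"
proof -
  have "0 < (norm (a - r))\<^sup>2" using \<open>r \<noteq> a\<close> by simp
  then have E: "0 < (a - r) \<bullet> (c - r)"
    using norm_square_le_inner_centre[of c r a] c by linarith
  have "dist c w \<le> 1" using w(1) c by (simp add: mem_disc_hull)
  moreover have "0 \<le> (norm (w - r))\<^sup>2" by simp
  ultimately have W: "0 \<le> (w - r) \<bullet> (c - r)"
    using norm_square_le_inner_centre[of c r w] c(1) by linarith
  consider k where "k \<le> 0" "p - r = k *\<^sub>R (a - r)"
    | s t where "0 \<le> s" "0 \<le> t" "w - r = s *\<^sub>R (a - r) + t *\<^sub>R (p - r)"
    using pdet_cone[OF \<sigma> E p(1) W p(2) w(2)] by blast
  then show ?thesis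
  proof cases
    case 1
    \<comment> \<open>Solves \<open>(1 - x) * k + x = 0\<close>, which writes \<open>r\<close> as a
      convex combination of \<open>p\<close> and \<open>a\<close>.\<close>
    define x where "x = - k / (1 - k)"
    have x: "0 \<le> x" "x \<le> 1" "(1 - x) * k + x = 0"
      using 1(1) by (auto simp: x_def field_simps)
    have "(1 - x) *\<^sub>R p + x *\<^sub>R a - r = (1 - x) *\<^sub>R (p - r) + x *\<^sub>R (a - r)" by (simp add: algebra_simps)
    also have "\<dots> = ((1 - x) * k + x) *\<^sub>R (a - r)" by (simp add: 1(2) scaleR_add_left)
    finally have "r = (1 - x) *\<^sub>R p + x *\<^sub>R a" using x(3) by simp
    then have "r \<in> closed_segment p a" using x by (auto simp: in_segment)
    then have "r \<in> disc_hull p a" using closed_segment_subset_disc_hull by blast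
    then show ?thesis using w(1) disc_hull_mono by blast
  next
    case 2
    then show ?thesis using disc_hull_subset_triangle[OF c p(1) w(1)] by blast
  qed
qed

text \<open>Used in contrapositive form: if \<open>r\<close> is outside
  \<open>disc_hull q a\<close>, then \<open>p\<close> lies on or beyond the tangent at
  \<open>r\<close>, as \<open>disc_hull_side\<close> demands.\<close>

lemma in_disc_hull_opposite:
  fixes a p q r c :: complex and \<sigma> l m n :: real
  assumes \<sigma>: "\<sigma> = 1 \<or> \<sigma> = -1" and c: "dist c r = 1" "dist c a = 1" and "r \<noteq> a"
    and c_side: "0 \<le> \<sigma> * pdet (c - r) (a - r)"
    and p: "0 < (p - r) \<bullet> (c - r)" "0 \<le> \<sigma> * pdet (a - r) (p - r)"
    and comb: "0 \<le> l" "0 \<le> m" "0 \<le> n" "l + m + n = 1" "l *\<^sub>R (p - r) + m *\<^sub>R (q - r) + n *\<^sub>R (a - r) = 0"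
  shows "r \<in> disc_hull q a"
proof -
  define u E P Q where "u = c - r" and "E = a - r" and "P = p - r" and "Q = q - r"
  note defs = u_def[symmetric] E_def[symmetric] P_def[symmetric] Q_def[symmetric]
  have u1: "(Re u)\<^sup>2 + (Im u)\<^sup>2 = 1"
    using c(1) unfolding cmod_power2[symmetric] by (simp add: u_def dist_norm)
  \<comment> \<open>As \<open>u\<close> is a unit vector, \<open>\<sigma> * pdet u v\<close> and
    \<open>v \<bullet> u\<close> are the coordinates of \<open>v\<close> in an orthonormal
    frame.\<close>
  have coords: "(\<sigma> * pdet u v)\<^sup>2 + (v \<bullet> u)\<^sup>2 = (norm v)\<^sup>2" for v
  proof -
    have "(\<sigma> * pdet u v)\<^sup>2 + (v \<bullet> u)\<^sup>2 = ((Re u)\<^sup>2 + (Im u)\<^sup>2) * (norm v)\<^sup>2"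
      using \<sigma> unfolding cmod_power2 pdet_def inner_complex_def
      by (auto simp: power2_eq_square algebra_simps)
    then show ?thesis using u1 by simp
  qed
  have pdet_diff: "pdet u (v - v') = pdet u v - pdet u v'" for v v'
    by (simp add: pdet_def algebra_simps)
  have "(norm (u - E))\<^sup>2 = 1" using c(2) by (simp add: u_def E_def dist_norm)
  then have EE: "(norm E)\<^sup>2 = 2 * (E \<bullet> u)"
    using u1 unfolding cmod_power2 inner_complex_def by (simp add: power2_eq_square algebra_simps)
  have "0 < (norm E)\<^sup>2" using \<open>r \<noteq> a\<close> by (simp add: E_def)
  then have Eu: "0 < E \<bullet> u" using EE by linarith
  have Pu: "0 < P \<bullet> u" and EP: "0 \<le> \<sigma> * pdet E P" and Es: "0 \<le> \<sigma> * pdet u E"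
    using p c_side by (auto simp: defs)
  \<comment> \<open>The direction of \<open>E\<close> lies between those of \<open>u\<close> and
    \<open>P\<close>.\<close>
  have cross: "(P \<bullet> u) * (\<sigma> * pdet u E) \<le> (E \<bullet> u) * (\<sigma> * pdet u P)"
  proof -
    have "(E \<bullet> u) * (\<sigma> * pdet u P) - (P \<bullet> u) * (\<sigma> * pdet u E) = ((Re u)\<^sup>2 + (Im u)\<^sup>2) * (\<sigma> * pdet E P)"
      unfolding pdet_def inner_complex_def by (simp add: power2_eq_square algebra_simps)
    then show ?thesis using u1 EP by simp
  qed
  have Ps: "0 \<le> \<sigma> * pdet u P"
  proof -
    have "0 \<le> (P \<bullet> u) * (\<sigma> * pdet u E)" using Pu Es by simp
    then have "0 \<le> (E \<bullet> u) * (\<sigma> * pdet u P)" using cross by linarith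
    then show ?thesis using Eu by (simp add: zero_le_mult_iff)
  qed
  have comb': "l *\<^sub>R P + m *\<^sub>R Q + n *\<^sub>R E = 0" using comb(5) by (simp add: defs)
  have Qu: "m * (- (Q \<bullet> u)) = l * (P \<bullet> u) + n * (E \<bullet> u)"
    using arg_cong[OF comb', of "\<lambda>v. v \<bullet> u"] by (simp add: inner_simps)
  have Qs: "m * (- (\<sigma> * pdet u Q)) = l * (\<sigma> * pdet u P) + n * (\<sigma> * pdet u E)"
  proof -
    have "l * pdet u P + m * pdet u Q + n * pdet u E = pdet u (l *\<^sub>R P + m *\<^sub>R Q + n *\<^sub>R E)"
      by (simp add: pdet_def algebra_simps)
    then have "l * pdet u P + m * pdet u Q + n * pdet u E = 0" using comb' by (simp add: pdet_def)
    then have "\<sigma> * (l * pdet u P + m * pdet u Q + n * pdet u E) = 0" by simp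
    then show ?thesis by (simp add: algebra_simps)
  qed
  \<comment> \<open>Otherwise a convex combination of \<open>P\<close> and \<open>E\<close> alone
    would vanish, although both have positive product with \<open>u\<close>.\<close>
  have m: "0 < m"
  proof (rule ccontr)
    assume "\<not> 0 < m"
    then have "m = 0" using comb by simp
    then have "l * (P \<bullet> u) + n * (E \<bullet> u) = 0" using Qu by simp
    moreover have "0 \<le> l * (P \<bullet> u)" "0 \<le> n * (E \<bullet> u)" using comb Pu Eu by auto
    ultimately have "l * (P \<bullet> u) = 0" "n * (E \<bullet> u) = 0" by linarith+
    then show False using Pu Eu comb(4) \<open>m = 0\<close> by auto
  qed
  have Qu0: "0 \<le> - (Q \<bullet> u)"
  proof -
    have "0 \<le> m * (- (Q \<bullet> u))" unfolding Qu using comb Pu Eu by simp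
    then show ?thesis using m zero_le_mult_iff by (metis less_asym not_le)
  qed
  have Qs0: "0 \<le> - (\<sigma> * pdet u Q)"
  proof -
    have "0 \<le> m * (- (\<sigma> * pdet u Q))" unfolding Qs using comb Ps Es by simp
    then show ?thesis using m zero_le_mult_iff by (metis less_asym not_le)
  qed
  \<comment> \<open>A positive multiple of \<open>- Q\<close> is a nonnegative combination of
    \<open>P\<close> and \<open>E\<close>, so \<open>- Q\<close> inherits the comparison
    \<open>cross\<close>.\<close>
  have slope: "- (Q \<bullet> u) * (\<sigma> * pdet u E) \<le> (E \<bullet> u) * (- (\<sigma> * pdet u Q))"
  proof -
    have "(m * (- (Q \<bullet> u))) * (\<sigma> * pdet u E) \<le> (E \<bullet> u) * (m * (- (\<sigma> * pdet u Q)))"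
      unfolding Qu Qs using mult_left_mono[OF cross comb(1)] by (simp add: algebra_simps)
    then have "m * (- (Q \<bullet> u) * (\<sigma> * pdet u E)) \<le> m * ((E \<bullet> u) * (- (\<sigma> * pdet u Q)))"
      by (simp add: mult.assoc mult.left_commute)
    then show ?thesis using m by (simp only: mult_le_cancel_left_pos)
  qed
  show ?thesis unfolding mem_disc_hull
  proof (intro allI impI)
    fix d assume d: "dist d q \<le> 1" "dist d a \<le> 1"
    define \<delta> where "\<delta> = d - r"
    have "(\<sigma> * pdet u \<delta> - \<sigma> * pdet u E)\<^sup>2 + (\<delta> \<bullet> u - E \<bullet> u)\<^sup>2 = (norm (\<delta> - E))\<^sup>2"
      unfolding coords[of "\<delta> - E", symmetric] by (simp add: pdet_diff inner_diff_left algebra_simps)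
    also have "\<dots> \<le> 1" using d(2) by (simp add: \<delta>_def E_def dist_norm power_le_one)
    finally have 1: "(\<sigma> * pdet u \<delta> - \<sigma> * pdet u E)\<^sup>2 + (\<delta> \<bullet> u - E \<bullet> u)\<^sup>2 \<le> 1" .
    have "(\<sigma> * pdet u \<delta> + - (\<sigma> * pdet u Q))\<^sup>2 + (\<delta> \<bullet> u + - (Q \<bullet> u))\<^sup>2 = (norm (\<delta> - Q))\<^sup>2"
      unfolding coords[of "\<delta> - Q", symmetric] by (simp add: pdet_diff inner_diff_left algebra_simps)
    also have "\<dots> \<le> 1" using d(1) by (simp add: \<delta>_def Q_def dist_norm power_le_one)
    finally have 2: "(\<sigma> * pdet u \<delta> + - (\<sigma> * pdet u Q))\<^sup>2 + (\<delta> \<bullet> u + - (Q \<bullet> u))\<^sup>2 \<le> 1" .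
    have "(\<sigma> * pdet u \<delta>)\<^sup>2 + (\<delta> \<bullet> u)\<^sup>2 \<le> 1"
      by (rule square_sum_le_1[OF Es Eu _ Qs0 Qu0 slope 1 2]) (simp only: coords EE)
    then show "dist d r \<le> 1"
      by (simp add: coords \<delta>_def dist_norm power_le_one_iff abs_square_le_1)
  qed
qed

text \<open>The line through \<open>r\<close> and \<open>a\<close> has \<open>p\<close> and
  \<open>q\<close> on opposite sides. It halves \<open>disc_hull r a\<close>, and
  \<open>disc_hull_side\<close> treats each half with a unit circle through \<open>r\<close> and
  \<open>a\<close> centred on the other side.\<close>

lemma disc_hull_subset_Un:
  fixes a p q r :: complex
  assumes r: "r \<in> convex hull {p, q, a}" and dist: "dist p a \<le> 2" "dist q a \<le> 2"
  shows "disc_hull r a \<subseteq> disc_hull p a \<union> disc_hull q a \<union> convex hull {p, r, a} \<union> convex hull {q, r, a}"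
proof (cases "r = a \<or> r \<in> disc_hull p a \<or> r \<in> disc_hull q a")
  case True
  then show ?thesis using disc_hull_mono by fastforce
next
  case False
  then have ra: "r \<noteq> a" and rp: "r \<notin> disc_hull p a" and rq: "r \<notin> disc_hull q a" by auto
  have "convex hull {p, q, a} \<subseteq> cball a 2"
    using dist by (intro hull_minimal) (auto simp: dist_commute)
  then have ra2: "dist r a \<le> 2" using r by (auto simp: dist_commute)
  obtain l m n where comb: "0 \<le> l" "0 \<le> m" "0 \<le> n" "l + m + n = 1" and req: "r = l *\<^sub>R p + m *\<^sub>R q + n *\<^sub>R a"
    using r unfolding convex_hull_3 by blast
  have n: "n = 1 - l - m" using comb by simp
  have zero: "l *\<^sub>R (p - r) + m *\<^sub>R (q - r) + n *\<^sub>R (a - r) = 0"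
  proof -
    have "l *\<^sub>R (p - r) + m *\<^sub>R (q - r) + n *\<^sub>R (a - r) = (l *\<^sub>R p + m *\<^sub>R q + n *\<^sub>R a) - (l + m + n) *\<^sub>R r"
      by (simp add: algebra_simps)
    then show ?thesis using comb req by simp
  qed
  have "l \<noteq> 0"
  proof
    assume "l = 0"
    then have "r \<in> closed_segment q a" using req comb unfolding in_segment by (intro exI[of _ n]) (auto simp: n)
    then show False using rq closed_segment_subset_disc_hull by blast
  qed
  moreover have "m \<noteq> 0"
  proof
    assume "m = 0"
    then have "r \<in> closed_segment p a" using req comb unfolding in_segment by (intro exI[of _ n]) (auto simp: n)
    then show False using rp closed_segment_subset_disc_hull by blast
  qed
  ultimately have lm: "0 < l" "0 < m" using comb by auto
  define \<sigma> :: real where "\<sigma> = (if 0 \<le> pdet (a - r) (p - r) then 1 else -1)"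
  have \<sigma>: "\<sigma> = 1 \<or> \<sigma> = -1" "- \<sigma> = 1 \<or> - \<sigma> = -1" by (auto simp: \<sigma>_def)
  have p\<sigma>: "0 \<le> \<sigma> * pdet (a - r) (p - r)" by (auto simp: \<sigma>_def)
  have q\<sigma>: "0 \<le> - \<sigma> * pdet (a - r) (q - r)"
  proof -
    have "l * pdet (a - r) (p - r) + m * pdet (a - r) (q - r)
        = pdet (a - r) (l *\<^sub>R (p - r) + m *\<^sub>R (q - r) + n *\<^sub>R (a - r))"
      by (simp add: pdet_def algebra_simps)
    then have "l * pdet (a - r) (p - r) + m * pdet (a - r) (q - r) = 0"
      using zero by (simp add: pdet_def)
    then have "m * (- \<sigma> * pdet (a - r) (q - r)) = l * (\<sigma> * pdet (a - r) (p - r))"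
      by algebra
    then have "0 \<le> m * (- \<sigma> * pdet (a - r) (q - r))" using lm p\<sigma> by simp
    then show ?thesis using lm by (meson less_asym not_le zero_le_mult_iff)
  qed
  obtain c where c: "dist c r = 1" "dist c a = 1" "0 \<le> \<sigma> * pdet (c - r) (a - r)"
    using ex_unit_disc_centre[OF ra ra2 \<sigma>(1)] .
  obtain c' where c': "dist c' r = 1" "dist c' a = 1" "0 \<le> - \<sigma> * pdet (c' - r) (a - r)"
    using ex_unit_disc_centre[OF ra ra2 \<sigma>(2)] .
  \<comment> \<open>The roles cross over: that \<open>r\<close> is outside the hull of
    \<open>q\<close> and \<open>a\<close> yields the tangent condition for \<open>p\<close>.\<close>
  have pc: "(p - r) \<bullet> (c - r) \<le> 0"
    using in_disc_hull_opposite[OF \<sigma>(1) c(1,2) ra c(3) _ p\<sigma> comb zero] rq by fastforce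
  have zero': "m *\<^sub>R (q - r) + l *\<^sub>R (p - r) + n *\<^sub>R (a - r) = 0" using zero by (simp add: add.commute)
  have comb': "m + l + n = 1" using comb by simp
  have qc: "(q - r) \<bullet> (c' - r) \<le> 0"
    using in_disc_hull_opposite[OF \<sigma>(2) c'(1,2) ra c'(3) _ q\<sigma> comb(2,1,3) comb' zero'] rp by fastforce
  show ?thesis
  proof
    fix w assume w: "w \<in> disc_hull r a"
    show "w \<in> disc_hull p a \<union> disc_hull q a \<union> convex hull {p, r, a} \<union> convex hull {q, r, a}"
    proof (cases "0 \<le> \<sigma> * pdet (a - r) (w - r)")
      case True
      then show ?thesis using disc_hull_side[OF \<sigma>(1) c(1,2) ra pc p\<sigma> w] by blast
    next
      case False
      then have "0 \<le> - \<sigma> * pdet (a - r) (w - r)" by simp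
      then show ?thesis using disc_hull_side[OF \<sigma>(2) c'(1,2) ra qc q\<sigma> w] by blast
    qed
  qed
qed

section \<open>Visibility via spindles\<close>

lemma triangle_subset:
  fixes F :: "complex set"
  assumes "compact F" "connected (- F)"
    and "closed_segment x y \<subseteq> F" "closed_segment y z \<subseteq> F" "closed_segment z x \<subseteq> F"
  shows "convex hull {x, y, z} \<subseteq> F"
  by (rule subset_if_frontier_subset[OF assms(1,2)]) (use assms in \<open>auto simp: frontier_of_triangle intro: bounded_convex_hull\<close>)

text \<open>The barycentric coordinates of \<open>y\<close> are quotients of signed areas.\<close>

lemma triangle_memI:
  assumes "0 < pdet (q - p) (a - p)" "0 \<le> pdet (q - p) (y - p)" "0 \<le> pdet (a - q) (y - q)" "0 \<le> pdet (p - a) (y - a)"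
  shows "y \<in> convex hull {p, q, a}"
proof -
  define D where "D = pdet (q - p) (a - p)"
  have D: "0 < D" using assms(1) by (simp add: D_def)
  have sum: "pdet (a - q) (y - q) + pdet (p - a) (y - a) + pdet (q - p) (y - p) = D"
    by (simp add: D_def pdet_def algebra_simps)
  have "D *\<^sub>R y = pdet (a - q) (y - q) *\<^sub>R p + pdet (p - a) (y - a) *\<^sub>R q + pdet (q - p) (y - p) *\<^sub>R a"
    unfolding D_def complex_eq_iff by (simp add: pdet_def algebra_simps)
  then have "(1 / D) *\<^sub>R (D *\<^sub>R y) = (1 / D) *\<^sub>R (pdet (a - q) (y - q) *\<^sub>R p + pdet (p - a) (y - a) *\<^sub>R q + pdet (q - p) (y - p) *\<^sub>R a)"
    by simp
  then have y: "y = (pdet (a - q) (y - q) / D) *\<^sub>R p + (pdet (p - a) (y - a) / D) *\<^sub>R q + (pdet (q - p) (y - p) / D) *\<^sub>R a"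
    using D by (simp add: scaleR_add_right)
  have "pdet (a - q) (y - q) / D + pdet (p - a) (y - a) / D + pdet (q - p) (y - p) / D = 1"
    using D sum by (simp flip: add_divide_distrib)
  then show ?thesis
    unfolding convex_hull_3 using assms D y by (intro CollectI exI conjI) auto
qed

lemma pdet_open_segment_pos:
  assumes "y \<in> open_segment p q" "0 < pdet (q - p) (a - p)"
  shows "0 < pdet (a - q) (y - q)" "0 < pdet (p - a) (y - a)"
proof -
  obtain t where t: "0 < t" "t < 1" and y: "y = (1 - t) *\<^sub>R p + t *\<^sub>R q"
    using assms(1) by (auto simp: in_segment)
  have "pdet (a - q) (y - q) = (1 - t) * pdet (q - p) (a - p)"
    unfolding y pdet_def by (simp add: algebra_simps)
  then show "0 < pdet (a - q) (y - q)" using t assms(2) by simp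
  have "pdet (p - a) (y - a) = t * pdet (q - p) (a - p)"
    unfolding y pdet_def by (simp add: algebra_simps)
  then show "0 < pdet (p - a) (y - a)" using t assms(2) by simp
qed

lemma open_pdet_pos: "open {y. 0 < pdet v (y - w)}"
  unfolding pdet_def by (intro open_Collect_less continuous_intros)

text \<open>Two triangles glued along \<open>p q\<close> from opposite sides have the open segment
  in the interior of their union \<open>K\<close>. So the frontier of \<open>K\<close> lies on the
  four given segments, and \<open>F\<close>, having no holes, contains \<open>K\<close>.\<close>

lemma diagonal_subset_strict:
  fixes F :: "complex set"
  assumes F: "compact F" "connected (- F)"
    and seg: "closed_segment p a \<subseteq> F" "closed_segment p b \<subseteq> F" "closed_segment q a \<subseteq> F" "closed_segment q b \<subseteq> F"
    and side: "0 < pdet (q - p) (a - p)" "pdet (q - p) (b - p) < 0"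
  shows "closed_segment p q \<subseteq> F"
proof -
  define K where "K = convex hull {p, q, a} \<union> convex hull {q, p, b}"
  have side': "0 < pdet (p - q) (b - q)" using side(2) by (simp add: pdet_def algebra_simps)
  have int: "y \<in> interior K" if y: "y \<in> open_segment p q" for y
  proof -
    \<comment> \<open>The points on the inner side of all four outer edges; which triangle contains
      them depends on their side of the line \<open>p q\<close>.\<close>
    define U where "U = {y. 0 < pdet (a - q) (y - q)} \<inter> {y. 0 < pdet (p - a) (y - a)}
      \<inter> {y. 0 < pdet (b - p) (y - p)} \<inter> {y. 0 < pdet (q - b) (y - b)}"
    have "open U" unfolding U_def by (intro open_Int open_pdet_pos)
    moreover have "y \<in> U"
      using pdet_open_segment_pos[OF y side(1)] pdet_open_segment_pos[of y q p b] y side'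
      by (simp add: U_def open_segment_commute)
    moreover have "U \<subseteq> K"
    proof
      fix z assume z: "z \<in> U"
      show "z \<in> K"
      proof (cases "0 \<le> pdet (q - p) (z - p)")
        case True
        then show ?thesis using z triangle_memI[OF side(1)] by (simp add: U_def K_def)
      next
        case False
        then have "0 \<le> pdet (p - q) (z - q)" by (simp add: pdet_def algebra_simps)
        then show ?thesis using z triangle_memI[OF side'] by (simp add: U_def K_def)
      qed
    qed
    ultimately show ?thesis by (auto simp: interior_def)
  qed
  have "frontier K \<subseteq> F"
  proof
    fix y assume y: "y \<in> frontier K"
    then have "y \<in> frontier (convex hull {p, q, a}) \<union> frontier (convex hull {q, p, b})"
      unfolding K_def using frontier_Un_subset by blast
    then have "y \<in> closed_segment p q \<union> closed_segment p a \<union> closed_segment p b \<union> closed_segment q a \<union> closed_segment q b"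
      by (auto simp: frontier_of_triangle closed_segment_commute)
    moreover have "y \<notin> open_segment p q" using y int by (auto simp: frontier_def)
    moreover have "p \<in> F" "q \<in> F" using seg by auto
    ultimately show "y \<in> F" using seg by (auto simp: open_segment_def)
  qed
  moreover have "bounded K" by (simp add: K_def bounded_convex_hull)
  ultimately have "K \<subseteq> F" using subset_if_frontier_subset[OF F] by blast
  moreover have "closed_segment p q \<subseteq> K"
    unfolding K_def segment_convex_hull by (intro le_supI1 hull_mono) auto
  ultimately show ?thesis by blast
qed

text \<open>With \<open>a\<close> at parameter \<open>k\<close> on the line, points of the segment
  at parameter \<open>t \<le> k\<close> lie between \<open>p\<close> and \<open>a\<close>, the
  others between \<open>q\<close> and \<open>a\<close>. Any real \<open>k\<close> is
  allowed.\<close>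

lemma collinear_segment_subset:
  assumes "pdet (q - p) (a - p) = 0"
  shows "closed_segment p q \<subseteq> closed_segment p a \<union> closed_segment q a"
proof (cases "p = q")
  case False
  define k where "k = ((a - p) \<bullet> (q - p)) / ((q - p) \<bullet> (q - p))"
  have pos: "(q - p) \<bullet> (q - p) > 0" using False by simp
  have "((q - p) \<bullet> (q - p)) *\<^sub>R (a - p) = ((a - p) \<bullet> (q - p)) *\<^sub>R (q - p)"
    using assms unfolding pdet_def complex_eq_iff inner_complex_def by simp algebra
  then have "(1 / ((q - p) \<bullet> (q - p))) *\<^sub>R (((q - p) \<bullet> (q - p)) *\<^sub>R (a - p)) = k *\<^sub>R (q - p)"
    by (simp add: k_def)
  then have "a - p = k *\<^sub>R (q - p)" using pos by simp
  then have a: "a = p + k *\<^sub>R (q - p)" by (simp add: algebra_simps)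
  show ?thesis
  proof
    fix y assume "y \<in> closed_segment p q"
    then obtain t where t: "0 \<le> t" "t \<le> 1" and y: "y = p + t *\<^sub>R (q - p)"
      by (auto simp: in_segment algebra_simps)
    show "y \<in> closed_segment p a \<union> closed_segment q a"
    proof (cases "t \<le> k")
      case True
      show ?thesis
      proof (cases "k = 0")
        case False
        then have "y = (1 - t / k) *\<^sub>R p + (t / k) *\<^sub>R a" unfolding a y by (simp add: algebra_simps)
        then show ?thesis using True t False by (auto simp: in_segment intro!: exI[of _ "t / k"])
      qed (use True t y in auto)
    next
      case False
      then have "k < 1" using t by simp
      have "y = q - (1 - t) *\<^sub>R (q - p)" unfolding y by (simp add: algebra_simps)
      also have "\<dots> = q - ((1 - t) / (1 - k)) *\<^sub>R ((1 - k) *\<^sub>R (q - p))" using \<open>k < 1\<close> by simp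
      also have "(1 - k) *\<^sub>R (q - p) = q - a" unfolding a by (simp add: algebra_simps)
      finally have "y = (1 - (1 - t) / (1 - k)) *\<^sub>R q + ((1 - t) / (1 - k)) *\<^sub>R a" by (simp add: algebra_simps)
      then show ?thesis using False t \<open>k < 1\<close> unfolding in_segment Un_iff
        by (intro disjI2 exI[of _ "(1 - t) / (1 - k)"]) auto
    qed
  qed
qed auto

text \<open>Because of \<open>m\<close>, the points \<open>a\<close> and \<open>b\<close> are not
  strictly on the same side of the line \<open>p q\<close>: either one is on the line or the line
  separates them.\<close>

lemma diagonal_subset:
  fixes F :: "complex set"
  assumes F: "compact F" "connected (- F)"
    and seg: "closed_segment p a \<subseteq> F" "closed_segment p b \<subseteq> F" "closed_segment q a \<subseteq> F" "closed_segment q b \<subseteq> F"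
    and m: "m \<in> closed_segment a b" "pdet (q - p) (m - p) = 0"
  shows "closed_segment p q \<subseteq> F"
proof -
  define \<alpha> \<beta> where "\<alpha> = pdet (q - p) (a - p)" and "\<beta> = pdet (q - p) (b - p)"
  obtain t where t: "0 \<le> t" "t \<le> 1" and meq: "m = (1 - t) *\<^sub>R a + t *\<^sub>R b"
    using m(1) by (auto simp: in_segment)
  have eq: "(1 - t) * \<alpha> + t * \<beta> = 0"
    using m(2) unfolding meq \<alpha>_def \<beta>_def pdet_def by (simp add: algebra_simps)
  consider "\<alpha> = 0" | "\<beta> = 0" | "0 < \<alpha>" "\<beta> < 0" | "0 < \<beta>" "\<alpha> < 0" | "0 < \<alpha>" "0 < \<beta>" | "\<alpha> < 0" "\<beta> < 0"
    by linarith
  then show ?thesis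
  proof cases
    case 1
    then show ?thesis using collinear_segment_subset[of q p a] seg by (auto simp: \<alpha>_def)
  next
    case 2
    then show ?thesis using collinear_segment_subset[of q p b] seg by (auto simp: \<beta>_def)
  next
    case 3
    then show ?thesis using diagonal_subset_strict[OF F seg] by (simp add: \<alpha>_def \<beta>_def)
  next
    case 4
    then show ?thesis using diagonal_subset_strict[OF F seg(2,1,4,3)] by (simp add: \<alpha>_def \<beta>_def)
  next
    case 5
    then have "0 \<le> (1 - t) * \<alpha>" "0 \<le> t * \<beta>" using t by auto
    then have "(1 - t) * \<alpha> = 0" "t * \<beta> = 0" using eq by linarith+
    then show ?thesis using 5 by auto
  next
    case 6
    then have "(1 - t) * \<alpha> \<le> 0" "t * \<beta> \<le> 0" using t by (auto simp: mult_nonneg_nonpos)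
    then have "(1 - t) * \<alpha> = 0" "t * \<beta> = 0" using eq by linarith+
    then show ?thesis using 6 by auto
  qed
qed

text \<open>Radon's theorem splits the points 2 + 2 or 1 + 3. Coinciding points fall under the last
  four cases.\<close>

lemma four_points_cases:
  fixes p q a b :: complex
  obtains "closed_segment p a \<inter> closed_segment q b \<noteq> {}"
    | "closed_segment p b \<inter> closed_segment q a \<noteq> {}"
    | "closed_segment p q \<inter> closed_segment a b \<noteq> {}"
    | "p \<in> convex hull {q, a, b}" | "q \<in> convex hull {p, a, b}"
    | "a \<in> convex hull {b, p, q}" | "b \<in> convex hull {a, p, q}"
proof (cases "distinct [p, q, a, b]")
  case False
  have "x \<in> convex hull {x, y, z}" "x \<in> convex hull {y, x, z}" "x \<in> convex hull {y, z, x}" for x y z :: complex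
    by (simp_all add: hull_inc)
  then show ?thesis using False that(4,5,6,7) by auto
next
  case True
  let ?X = "{p, q, a, b}"
  have "card ?X = 4" using True by simp
  then have "affine_dependent ?X" by (intro affine_dependent_biggerset) auto
  then obtain M P where MP: "M \<subseteq> ?X" "P \<subseteq> ?X" "M \<inter> P = {}" "convex hull M \<inter> convex hull P \<noteq> {}"
    by (rule Radon)
  \<comment> \<open>Enlarging \<open>P\<close> to the complement of \<open>M\<close> lets
    \<open>M\<close> alone decide the case, so only the subsets of \<open>?X\<close> are left to
    inspect.\<close>
  then have "P \<subseteq> ?X - M" by auto
  then have ne: "convex hull M \<inter> convex hull (?X - M) \<noteq> {}" using MP(4) hull_mono by blast
  have "M \<in> Pow ?X" using MP(1) by simp
  then show ?thesis using ne True that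
    unfolding Pow_insert Pow_empty 
    by (auto simp: insert_Diff_if segment_convex_hull insert_commute Int_commute) blast+
qed

section \<open>Paths of points that see \<open>a\<close> and \<open>b\<close>\<close>

lemma disc_hull_subset_on_segment:
  fixes F :: "complex set"
  assumes F: "compact F" "connected (- F)"
    and sub: "disc_hull p a \<subseteq> F" "disc_hull q a \<subseteq> F" "closed_segment p q \<subseteq> F"
    and dist: "dist p a \<le> 2" "dist q a \<le> 2" and r: "r \<in> closed_segment p q"
  shows "disc_hull r a \<subseteq> F"
proof -
  have "closed_segment q a \<subseteq> F" "closed_segment a p \<subseteq> F"
    using sub closed_segment_subset_disc_hull[of q a] closed_segment_subset_disc_hull[of p a]
    by (auto simp: closed_segment_commute[of a p])
  then have tri: "convex hull {p, q, a} \<subseteq> F" using sub by (intro triangle_subset F) auto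
  have rh: "r \<in> convex hull {p, q, a}"
    using r hull_mono[of "{p, q}" "{p, q, a}"] by (auto simp: segment_convex_hull)
  have "convex hull {p, r, a} \<subseteq> convex hull {p, q, a}" "convex hull {q, r, a} \<subseteq> convex hull {p, q, a}"
    using rh by (simp_all add: hull_minimal hull_inc)
  then show ?thesis using disc_hull_subset_Un[OF rh dist] sub tri by blast
qed

text \<open>The line from \<open>y\<close> through \<open>x\<close> reaches the side opposite to
  \<open>y\<close>.\<close>

lemma convex_hull_3_collinear:
  assumes "x \<in> convex hull {y, c, d}"
  obtains m where "m \<in> closed_segment c d" "pdet (y - x) (m - x) = 0"
proof -
  obtain u v m where uv: "0 \<le> u" "0 \<le> v" "u + v = 1" and m: "m \<in> convex hull {c, d}" and x: "x = u *\<^sub>R y + v *\<^sub>R m"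
    using assms convex_hull_insert[of "{c, d}" y] by auto
  have v: "v = 1 - u" using uv by simp
  have "pdet (y - x) (m - x) = 0" unfolding x v pdet_def by (simp add: algebra_simps)
  then show thesis using m that by (auto simp: segment_convex_hull)
qed

text \<open>In the next two lemmas the path from \<open>p\<close> to \<open>q\<close> bends at \<open>z\<close>, respectively at \<open>a\<close>; they treat
  its first half.\<close>

lemma disc_hull_visible_crossing:
  fixes F :: "complex set"
  assumes F: "compact F" "connected (- F)"
    and sub: "disc_hull p a \<subseteq> F" "disc_hull p b \<subseteq> F" "disc_hull q b \<subseteq> F"
    and dist: "dist p b \<le> 2" "dist q b \<le> 2"
    and z: "z \<in> closed_segment p a" "z \<in> closed_segment q b" and r: "r \<in> closed_segment p z"
  shows "disc_hull r a \<subseteq> F" "disc_hull r b \<subseteq> F"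
proof -
  have pz: "closed_segment p z \<subseteq> closed_segment p a" using z(1) by (simp add: subset_closed_segment)
  then have "r \<in> disc_hull p a" using r closed_segment_subset_disc_hull by blast
  then show "disc_hull r a \<subseteq> F" using disc_hull_mono sub(1) by blast
  have "z \<in> disc_hull q b" using z(2) closed_segment_subset_disc_hull by blast
  \<comment> \<open>Now both ends of the segment \<open>p z\<close> see \<open>b\<close>, so
    \<open>disc_hull_subset_on_segment\<close> applies.\<close>
  then have zb: "disc_hull z b \<subseteq> F" using disc_hull_mono sub(3) by blast
  have "closed_segment p z \<subseteq> F" using pz closed_segment_subset_disc_hull sub(1) by blast
  moreover have "dist z b \<le> 2"
    using z(2) dist(2) closed_segment_subset[of q "cball b 2" b] by (auto simp: dist_commute)
  ultimately show "disc_hull r b \<subseteq> F"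
    using disc_hull_subset_on_segment[OF F sub(2) zb _ dist(1) _ r] by blast
qed

lemma disc_hull_visible_reflex:
  fixes F :: "complex set"
  assumes F: "compact F" "connected (- F)"
    and sub: "disc_hull p a \<subseteq> F" "disc_hull p b \<subseteq> F" "disc_hull q a \<subseteq> F" "disc_hull q b \<subseteq> F"
    and dist: "dist p b \<le> 2" "dist q b \<le> 2"
    and a: "a \<in> convex hull {b, p, q}" and r: "r \<in> closed_segment p a"
  shows "disc_hull r a \<subseteq> F" "disc_hull r b \<subseteq> F"
proof -
  have seg: "closed_segment p a \<subseteq> F" "closed_segment p b \<subseteq> F" "closed_segment q a \<subseteq> F" "closed_segment q b \<subseteq> F"
    using sub closed_segment_subset_disc_hull by blast+
  obtain m where "m \<in> closed_segment p q" "pdet (b - a) (m - a) = 0"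
    using convex_hull_3_collinear[OF a] .
  \<comment> \<open>The line \<open>a b\<close> meets the segment \<open>p q\<close>, so
    \<open>diagonal_subset\<close> is used with the two pairs exchanged.\<close>
  then have ab: "closed_segment a b \<subseteq> F"
    using seg by (intro diagonal_subset[OF F, of a p q b m]) (auto simp: closed_segment_commute)
  have a': "a \<in> convex hull {p, q, b}" using a by (simp add: insert_commute)
  have "convex hull {p, a, b} \<subseteq> F" "convex hull {q, a, b} \<subseteq> F"
    by (rule triangle_subset[OF F]; use seg ab in \<open>simp add: closed_segment_commute\<close>)+
  then have hab: "disc_hull a b \<subseteq> F" using disc_hull_subset_Un[OF a' dist] sub by blast
  have "convex hull {b, p, q} \<subseteq> cball b 2"
    using dist by (intro hull_minimal) (auto simp: dist_commute)
  then have "dist a b \<le> 2" using a by (auto simp: dist_commute)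
  then show "disc_hull r b \<subseteq> F"
    using disc_hull_subset_on_segment[OF F sub(2) hab seg(1) dist(1) _ r] by blast
  have "r \<in> disc_hull p a" using r closed_segment_subset_disc_hull by blast
  then show "disc_hull r a \<subseteq> F" using disc_hull_mono sub(1) by blast
qed

lemma disc_hull_visible_connected:
  fixes F :: "complex set"
  assumes F: "compact F" "connected (- F)"
    and sub: "disc_hull p a \<subseteq> F" "disc_hull p b \<subseteq> F" "disc_hull q a \<subseteq> F" "disc_hull q b \<subseteq> F"
    and dist: "dist p a \<le> 2" "dist p b \<le> 2" "dist q a \<le> 2" "dist q b \<le> 2"
  shows "\<exists>C. connected C \<and> p \<in> C \<and> q \<in> C \<and> (\<forall>r\<in>C. disc_hull r a \<subseteq> F \<and> disc_hull r b \<subseteq> F)"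
proof -
  have path: ?thesis
    if "\<And>r. r \<in> closed_segment p z \<or> r \<in> closed_segment q z \<Longrightarrow> disc_hull r a \<subseteq> F \<and> disc_hull r b \<subseteq> F" for z
  proof (intro exI[of _ "closed_segment p z \<union> closed_segment q z"] conjI)
    show "connected (closed_segment p z \<union> closed_segment q z)"
      by (rule connected_Un) auto
  qed (use that in auto)
  \<comment> \<open>A straight path works as soon as the line \<open>p q\<close>, not necessarily
    the segment, meets the segment \<open>a b\<close>. This also covers \<open>p\<close> or
    \<open>q\<close> in the triangle of the other three points.\<close>
  have direct: ?thesis if "m \<in> closed_segment a b" "pdet (q - p) (m - p) = 0" for m
  proof (rule path[of q])
    have seg: "closed_segment p a \<subseteq> F" "closed_segment p b \<subseteq> F" "closed_segment q a \<subseteq> F" "closed_segment q b \<subseteq> F"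
      using sub closed_segment_subset_disc_hull by blast+
    have pq: "closed_segment p q \<subseteq> F" using diagonal_subset[OF F seg that] .
    fix r assume "r \<in> closed_segment p q \<or> r \<in> closed_segment q q"
    then have r: "r \<in> closed_segment p q" by auto
    show "disc_hull r a \<subseteq> F \<and> disc_hull r b \<subseteq> F"
      using disc_hull_subset_on_segment[OF F sub(1,3) pq dist(1,3) r]
        disc_hull_subset_on_segment[OF F sub(2,4) pq dist(2,4) r] by blast
  qed
  consider "closed_segment p a \<inter> closed_segment q b \<noteq> {}"
    | "closed_segment p b \<inter> closed_segment q a \<noteq> {}"
    | "closed_segment p q \<inter> closed_segment a b \<noteq> {}"
    | "p \<in> convex hull {q, a, b}" | "q \<in> convex hull {p, a, b}"
    | "a \<in> convex hull {b, p, q}" | "b \<in> convex hull {a, p, q}"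
    by (rule four_points_cases)
  then show ?thesis
  proof cases
    case 1
    then obtain z where z: "z \<in> closed_segment p a" "z \<in> closed_segment q b" by blast
    show ?thesis
      using disc_hull_visible_crossing[OF F sub(1,2,4) dist(2,4) z]
        disc_hull_visible_crossing[OF F sub(4,3,1) dist(3,1) z(2,1)] by (intro path[of z]) blast
  next
    case 2
    then obtain z where z: "z \<in> closed_segment p b" "z \<in> closed_segment q a" by blast
    show ?thesis
      using disc_hull_visible_crossing[OF F sub(2,1,3) dist(1,3) z]
        disc_hull_visible_crossing[OF F sub(3,4,2) dist(4,2) z(2,1)] by (intro path[of z]) blast
  next
    case 3
    then obtain m where m: "m \<in> closed_segment p q" "m \<in> closed_segment a b" by blast
    obtain u where u: "m = (1 - u) *\<^sub>R p + u *\<^sub>R q" using m(1) by (auto simp: in_segment)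
    have "pdet (q - p) (m - p) = 0" unfolding u pdet_def by (simp add: algebra_simps)
    then show ?thesis using direct m by blast
  next
    case 4
    then show ?thesis using direct by (metis convex_hull_3_collinear)
  next
    case 5
    then obtain m where "m \<in> closed_segment a b" "pdet (p - q) (m - q) = 0"
      by (rule convex_hull_3_collinear)
    moreover from this have "pdet (q - p) (m - p) = 0" by (simp add: pdet_def algebra_simps)
    ultimately show ?thesis using direct by blast
  next
    case 6
    then have 6: "a \<in> convex hull {b, p, q}" "a \<in> convex hull {b, q, p}" by (simp_all add: insert_commute)
    show ?thesis
      using disc_hull_visible_reflex[OF F sub dist(2,4) 6(1)]
        disc_hull_visible_reflex[OF F sub(3,4,1,2) dist(4,2) 6(2)] by (intro path[of a]) blast
  next
    case 7
    then have 7: "b \<in> convex hull {a, p, q}" "b \<in> convex hull {a, q, p}" by (simp_all add: insert_commute)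
    show ?thesis
      using disc_hull_visible_reflex[OF F sub(2,1,4,3) dist(1,3) 7(1)]
        disc_hull_visible_reflex[OF F sub(4,3,2,1) dist(3,1) 7(2)] by (intro path[of b]) blast
  qed
qed

section \<open>Connected pairwise intersections and the conclusion\<close>

lemma connected_disc_hull_kernel_Int:
  fixes S :: "complex set"
  assumes S: "simply_connected S" and diam: "\<And>x y. x \<in> S \<Longrightarrow> y \<in> S \<Longrightarrow> dist x y \<le> 2"
    and ab: "a \<in> S" "b \<in> S"
  shows "connected ({p \<in> S. disc_hull p a \<subseteq> S} \<inter> {p \<in> S. disc_hull p b \<subseteq> S})" (is "connected ?V")
  unfolding connected_iff_connected_component
proof (intro ballI)
  fix p q assume p: "p \<in> ?V" and q: "q \<in> ?V"
  have dist: "dist p a \<le> 2" "dist p b \<le> 2" "dist q a \<le> 2" "dist q b \<le> 2"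
    using p q ab diam by auto
  let ?H = "{disc_hull p a, disc_hull p b, disc_hull q a, disc_hull q b}"
  define T where "T = \<Union> ?H"
  have TS: "T \<subseteq> S" using p q by (auto simp: T_def)
  have cT: "compact T" unfolding T_def using dist by (auto intro!: compact_Un compact_disc_hull)
  have pc: "path_connected (disc_hull x y)" for x y :: complex
    by (simp add: convex_disc_hull convex_imp_path_connected)
  \<comment> \<open>The hulls in each bracket share \<open>a\<close> or \<open>b\<close>, and both
    brackets contain \<open>p\<close>.\<close>
  have "path_connected ((disc_hull p a \<union> disc_hull q a) \<union> (disc_hull p b \<union> disc_hull q b))"
    using left_in_disc_hull right_in_disc_hull by (intro path_connected_Un pc) blast+
  moreover have "T = (disc_hull p a \<union> disc_hull q a) \<union> (disc_hull p b \<union> disc_hull q b)"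
    by (auto simp: T_def)
  ultimately have pT: "path_connected T" by simp
  \<comment> \<open>A finite union of closed convex sets is an ANR; this supplies the local path
    connectedness needed for lifting.\<close>
  have "ANR T" unfolding T_def
    by (rule ANR_finite_Union_convex_closed) (auto simp: closed_disc_hull convex_disc_hull)
  then have lT: "locally path_connected T" by (rule ANR_imp_locally_path_connected)
  \<comment> \<open>The complement of \<open>F\<close> is \<open>outside T\<close>, which is open,
    and connected because \<open>T\<close> is bounded.\<close>
  define F where "F = T \<union> inside T"
  have FS: "F \<subseteq> S" using simply_connected_imp_inside_subset[OF S TS cT pT lT] TS by (simp add: F_def)
  have "closed F" unfolding F_def union_with_inside
    using cT by (simp add: compact_imp_closed closed_Compl open_outside)
  then have cF: "compact F"
    using cT by (simp add: F_def compact_eq_bounded_closed bounded_inside)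
  have conF: "connected (- F)"
    using cT unfolding F_def union_with_inside by (simp add: connected_outside compact_imp_bounded)
  have sub: "disc_hull p a \<subseteq> F" "disc_hull p b \<subseteq> F" "disc_hull q a \<subseteq> F" "disc_hull q b \<subseteq> F"
    by (auto simp: F_def T_def)
  obtain C where C: "connected C" "p \<in> C" "q \<in> C"
    "\<And>r. r \<in> C \<Longrightarrow> disc_hull r a \<subseteq> F \<and> disc_hull r b \<subseteq> F"
    using disc_hull_visible_connected[OF cF conF sub dist] by blast
  have "C \<subseteq> ?V" using C(4) FS left_in_disc_hull by blast
  then show "connected_component ?V p q" using C(1-3) unfolding connected_component_def by blast
qed

proposition disc_hull_Krasnoselskii:
  fixes S A :: "complex set"
  assumes "S \<noteq> {}" "compact S" "simply_connected S" and diam: "\<And>x y. x \<in> S \<Longrightarrow> y \<in> S \<Longrightarrow> dist x y \<le> 2"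
    and A: "finite A" "A \<subseteq> S"
    and triple: "\<And>a b c. a \<in> A \<Longrightarrow> b \<in> A \<Longrightarrow> c \<in> A \<Longrightarrow>
      \<exists>p\<in>S. disc_hull p a \<subseteq> S \<and> disc_hull p b \<subseteq> S \<and> disc_hull p c \<subseteq> S"
  shows "\<exists>p\<in>S. \<forall>a\<in>A. disc_hull p a \<subseteq> S"
proof (cases "A = {}")
  case False
  let ?V = "\<lambda>a. {p \<in> S. disc_hull p a \<subseteq> S}"
  have cpt: "compact (?V a)" for a
  proof -
    have "compact (S \<inter> ?V a)"
      using assms(2) by (intro compact_Int_closed closed_disc_hull_kernel compact_imp_closed)
    moreover have "S \<inter> ?V a = ?V a" by auto
    ultimately show ?thesis by simp
  qed
  have "(\<Inter>a\<in>A. ?V a) \<noteq> {}"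
  proof (rule planar_Helly[OF A(1) False cpt])
    fix a assume a: "a \<in> A"
    \<comment> \<open>A starlike set is Borsukian, and a compact Borsukian set does not separate the
      plane.\<close>
    have "Borsukian (?V a)" using a A by (intro starlike_imp_Borsukian starlike_disc_hull_kernel) auto
    then show "connected (- ?V a)" using Borsukian_separation_compact cpt by blast
    fix b assume b: "b \<in> A"
    show "connected (?V a \<inter> ?V b)"
      using a b A diam assms(3) by (intro connected_disc_hull_kernel_Int) auto
    fix c assume "c \<in> A"
    then show "?V a \<inter> ?V b \<inter> ?V c \<noteq> {}" using triple[OF a b] by blast
  qed
  then show ?thesis using False by auto
qed (use assms(1) in auto)

theorem theorem8:
  fixes S A :: "(real^2) set"
  assumes "S \<noteq> {}"
    and "compact S"
    and "simply_connected S"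
    and "diameter S \<le> 2"
    and "finite A"
    and "A \<subseteq> S"
    and "\<And>a1 a2 a3. a1 \<in> A \<Longrightarrow> a2 \<in> A \<Longrightarrow> a3 \<in> A \<Longrightarrow>
           \<exists>p\<in>S. spindle p a1 \<subseteq> S \<and> spindle p a2 \<subseteq> S \<and> spindle p a3 \<subseteq> S"
  shows "\<exists>p\<in>S. \<forall>a\<in>A. spindle p a \<subseteq> S"
proof -
  \<comment> \<open>The isometry \<open>f\<close> carries the problem to the complex plane, where
    the preceding results are stated.\<close>
  define f :: "real^2 \<Rightarrow> complex" where "f x = Complex (x $ 1) (x $ 2)" for x
  define g :: "complex \<Rightarrow> real^2" where "g z = vector [Re z, Im z]" for z
  have fg: "f (g z) = z" for z by (simp add: f_def g_def)
  have gf: "g (f x) = x" for x by (simp add: f_def g_def vec_eq_iff forall_2)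
  have dist: "dist (f x) (f y) = dist x y" for x y
    by (simp add: f_def dist_norm norm_vec_def L2_set_def sum_2 cmod_def)
  have diam: "dist x y \<le> 2" if "x \<in> S" "y \<in> S" for x y
    using diameter_bounded_bound[OF compact_imp_bounded[OF assms(2)] that] assms(4) by linarith
  have contf: "continuous_on UNIV f" and contg: "continuous_on UNIV g"
    unfolding continuous_on_iff using dist fg by metis+
  have homeo: "S homeomorphic f ` S"
    unfolding homeomorphic_minimal
    by (rule exI[of _ f], rule exI[of _ g])
      (auto simp: gf intro: continuous_on_subset[OF contf] continuous_on_subset[OF contg])
  \<comment> \<open>The bound on the distance selects the first branch of \<open>spindle\<close>;
    \<open>diam\<close> provides it for points of \<open>S\<close>.\<close>
  have hull: "f w \<in> disc_hull (f x) (f y) \<longleftrightarrow> w \<in> spindle x y" if "dist x y \<le> 2" for w x y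
  proof -
    have "f w \<in> disc_hull (f x) (f y) \<longleftrightarrow> (\<forall>c. dist (f c) (f x) \<le> 1 \<longrightarrow> dist (f c) (f y) \<le> 1 \<longrightarrow> dist (f c) (f w) \<le> 1)"
      unfolding mem_disc_hull by (metis fg)
    then show ?thesis using that by (auto simp: spindle_def dist)
  qed
  have iff: "disc_hull (f p) (f a) \<subseteq> f ` S \<longleftrightarrow> spindle p a \<subseteq> S" if "p \<in> S" "a \<in> S" for p a
  proof -
    have "disc_hull (f p) (f a) \<subseteq> f ` S \<longleftrightarrow> (\<forall>w. f w \<in> disc_hull (f p) (f a) \<longrightarrow> f w \<in> f ` S)"
      by (metis fg subset_iff)
    also have "\<dots> \<longleftrightarrow> (\<forall>w. w \<in> spindle p a \<longrightarrow> w \<in> S)"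
      using hull[OF diam[OF that]] inj_image_mem_iff[OF inj_on_inverseI[of UNIV g f]] gf by simp
    finally show ?thesis by blast
  qed
  have "\<exists>p\<in>f ` S. \<forall>a\<in>f ` A. disc_hull p a \<subseteq> f ` S"
  proof (rule disc_hull_Krasnoselskii)
    show "compact (f ` S)"
      using assms(2) contf continuous_on_subset by (blast intro: compact_continuous_image)
    show "simply_connected (f ` S)" using homeomorphic_simply_connected[OF homeo assms(3)] .
    fix a b c assume "a \<in> f ` A" "b \<in> f ` A" "c \<in> f ` A"
    then obtain a' b' c' where abc: "a = f a'" "b = f b'" "c = f c'" "a' \<in> A" "b' \<in> A" "c' \<in> A" by blast
    then obtain p where p: "p \<in> S" "spindle p a' \<subseteq> S" "spindle p b' \<subseteq> S" "spindle p c' \<subseteq> S"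
      using assms(7) by blast
    then show "\<exists>p\<in>f ` S. disc_hull p a \<subseteq> f ` S \<and> disc_hull p b \<subseteq> f ` S \<and> disc_hull p c \<subseteq> f ` S"
      using abc assms(6) iff by (intro bexI[of _ "f p"]) (simp_all add: subset_iff[of A])
  qed (use assms diam dist in auto)
  then obtain p where p: "p \<in> S" "\<And>a. a \<in> A \<Longrightarrow> disc_hull (f p) (f a) \<subseteq> f ` S" by auto
  then have "spindle p a \<subseteq> S" if "a \<in> A" for a using iff[of p a] assms(6) that by blast
  then show ?thesis using p(1) by blast
qed

end
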